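(* Let $\gamma,\eta,\lambda\in\mathbb{R}$, $a\in\mathbb{C}$, $k\in\mathbb{Z}$, $m\in\mathbb{N}$ and $n\in\mathbb{N}_0$. Then the generalized Apostol-Bernoulli poly-Daehee polynomials satisfy $${}_{\mathfrak{B}}\mathfrak{D}_{n,a}^{[k,m-1]}(\gamma,\eta+1;\lambda)=\sum_{j=0}^{n}\binom{n}{j}\;{}_{\mathfrak{B}}\mathfrak{D}_{n-j,a}^{[k,m-1]}(\gamma,\eta;\lambda).$$
   Context: $\mathbb{N}=\{1,2,\dots\}$, $\mathbb{N}_0=\mathbb{N}\cup\{0\}$. The polylogarithm is $\mathrm{Li}_k(z)=\sum_{r=1}^{\infty} z^r/r^k$. Generalized Apostol-Bernoulli poly-Daehee polynomials (GABPDP), defined by the generating function $$(1+x)^{\gamma}\,\frac{\log(1+x)}{\mathrm{Li}_k(1-e^{-x})}\,e^{\eta x}\left(\frac{x^m}{\lambda e^x-\sum_{l=0}^{m-1}\frac{x^l}{l!}}\right)^{a}=\sum_{n=0}^\infty {}_{\mathfrak{B}}\mathfrak{D}_{n,a}^{[k,m-1]}(\gamma,\eta;\lambda)\frac{x^n}{n!}.$$ *)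

theory Defs
  imports "HOL-Complex_Analysis.Complex_Analysis"
begin

(* Only |z| < 1 is relevant below; the order k may be any integer. *)
definition polylog :: "int \<Rightarrow> complex \<Rightarrow> complex" where
  "polylog k z = (\<Sum>r. z ^ Suc r / of_nat (Suc r) powi k)"

(* All complex powers and logarithms are principal.  At x = 0 the expression has
   the form 0/0, so its value there carries no meaning. *)
definition gabpdp_gen ::
  "int \<Rightarrow> nat \<Rightarrow> complex \<Rightarrow> real \<Rightarrow> real \<Rightarrow> real \<Rightarrow> complex \<Rightarrow> complex" where
  "gabpdp_gen k m a \<gamma> \<eta> lam x =
     (1 + x) powr of_real \<gamma> * (Ln (1 + x) / polylog k (1 - exp (- x))) * exp (of_real \<eta> * x) *
     (x ^ m / (of_real lam * exp x - (\<Sum>i<m. x ^ i / fact i))) powr a"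

(* F is the power series (no negative powers) of the generating function in a punctured
   neighbourhood of 0. *)
definition gabpdp_expansion ::
  "int \<Rightarrow> nat \<Rightarrow> complex \<Rightarrow> real \<Rightarrow> real \<Rightarrow> real \<Rightarrow> complex fps \<Rightarrow> bool" where
  "gabpdp_expansion k m a \<gamma> \<eta> lam F \<longleftrightarrow>
     gabpdp_gen k m a \<gamma> \<eta> lam has_laurent_expansion fps_to_fls F"

(* gabpdp k m a n \<gamma> \<eta> lam has the superscript [k, m - 1] and the subscripts n, a.
   If the generating function is not a power series in x (possible only for lam \<noteq> 1, e.g.
   a = 1/2 and m = 1, or a = -1), then it defines nothing and the value is 0 by convention. *)
definition gabpdp ::
  "int \<Rightarrow> nat \<Rightarrow> complex \<Rightarrow> nat \<Rightarrow> real \<Rightarrow> real \<Rightarrow> real \<Rightarrow> complex" where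
  "gabpdp k m a n \<gamma> \<eta> lam =
     (if \<exists>F. gabpdp_expansion k m a \<gamma> \<eta> lam F
      then fact n * fps_nth (THE F. gabpdp_expansion k m a \<gamma> \<eta> lam F) n else 0)"

lemma gabpdp_expansion_unique:
  assumes "gabpdp_expansion k m a \<gamma> \<eta> lam F" "gabpdp_expansion k m a \<gamma> \<eta> lam G"
  shows "F = G"
  using has_laurent_expansion_unique[of _ "fps_to_fls F" "fps_to_fls G"] assms
  unfolding gabpdp_expansion_def by (metis fps_to_fls_eq_iff)

lemma gabpdp_eq:
  assumes "gabpdp_expansion k m a \<gamma> \<eta> lam F"
  shows "gabpdp k m a n \<gamma> \<eta> lam = fact n * fps_nth F n"
proof -
  have "(THE F. gabpdp_expansion k m a \<gamma> \<eta> lam F) = F"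
    using assms gabpdp_expansion_unique by blast
  thus ?thesis using assms unfolding gabpdp_def by auto
qed

lemma gabpdp_sums:
  assumes "gabpdp_expansion k m a \<gamma> \<eta> lam F"
  shows "\<forall>\<^sub>F x in at 0. (\<lambda>n. gabpdp k m a n \<gamma> \<eta> lam * x ^ n / fact n) sums gabpdp_gen k m a \<gamma> \<eta> lam x"
proof -
  have r: "fps_conv_radius F > 0" and e: "\<forall>\<^sub>F x in at 0. eval_fls (fps_to_fls F) x = gabpdp_gen k m a \<gamma> \<eta> lam x"
    using assms unfolding gabpdp_expansion_def has_laurent_expansion_def by auto
  have "\<forall>\<^sub>F x in at 0. x \<in> eball (0::complex) (fps_conv_radius F)"
    using r by (intro eventually_at_in_open' open_eball) (auto simp: zero_ereal_def)
  thus ?thesis using e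
  proof eventually_elim
    case (elim x)
    have "(\<lambda>n. fps_nth F n * x ^ n) sums eval_fps F x"
      using elim(1) by (intro sums_eval_fps) auto
    moreover have "eval_fls (fps_to_fls F) x = eval_fps F x"
      using elim(1) by (intro eval_fps_to_fls) auto
    ultimately show ?case using elim(2) by (simp add: gabpdp_eq[OF assms])
  qed
qed

lemma polylog_expansion:
  "polylog k has_fps_expansion Abs_fps (\<lambda>r. if r = 0 then 0 else 1 / of_nat r powi k)"
    (is "_ has_fps_expansion ?F")
proof (rule has_fps_expansionI)
  have "(\<lambda>r. fps_nth ?F r * z ^ r) sums polylog k z" if z: "norm z < 1" for z
  proof -
    define j where "j = nat \<bar>k\<bar>"
    have "summable (\<lambda>r. fps_nth ?F r * z ^ r)"
    proof (rule summable_comparison_test)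
      have "norm (fps_nth ?F r * z ^ r) \<le> norm (of_nat r ^ j * z ^ r)" for r
      proof (cases "r = 0")
        case False
        have "norm (1 / of_nat r powi k :: complex) = real r powi (-k)"
          using False by (simp add: norm_divide norm_power_int power_int_minus field_simps)
        also have "\<dots> \<le> real r powi (int j)"
          using False by (intro power_int_increasing) (auto simp: j_def)
        finally have "norm (1 / of_nat r powi k :: complex) \<le> real r ^ j" by simp
        from mult_right_mono[OF this, of "norm z ^ r"] show ?thesis
          using False by (simp add: norm_mult norm_power norm_divide)
      qed auto
      thus "\<exists>N. \<forall>r\<ge>N. norm (fps_nth ?F r * z ^ r) \<le> norm (of_nat r ^ j * z ^ r)" by blast
      show "summable (\<lambda>r. norm (of_nat r ^ j * z ^ r))"
      proof (rule abs_summable_in_conv_radius)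
        have "(\<lambda>n. (real n / real (Suc n)) ^ j) \<longlonglongrightarrow> 1 ^ j"
          by (intro tendsto_power LIMSEQ_n_over_Suc_n)
        hence "(\<lambda>n. norm (of_nat n ^ j :: complex) / norm (of_nat (Suc n) ^ j :: complex)) \<longlonglongrightarrow> 1"
          by (simp add: norm_power power_divide del: of_nat_Suc)
        hence "conv_radius (\<lambda>n. of_nat n ^ j :: complex) = 1"
          using conv_radius_ratio_limit_nonzero[of 1 1 "\<lambda>n. of_nat n ^ j :: complex"]
          by (simp add: one_ereal_def)
        thus "ereal (norm z) < conv_radius (\<lambda>n. of_nat n ^ j :: complex)"
          using z by simp
      qed
    qed
    hence "summable (\<lambda>r. fps_nth ?F (Suc r) * z ^ Suc r)"
      by (subst summable_Suc_iff)
    hence "(\<lambda>r. fps_nth ?F (Suc r) * z ^ Suc r) sums polylog k z"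
      unfolding polylog_def by (simp add: summable_sums_iff field_simps)
    thus ?thesis by (subst (asm) sums_Suc_iff) simp
  qed
  moreover have "\<forall>\<^sub>F z in nhds (0::complex). norm z < 1"
    by (rule eventually_nhds_in_open[of "ball 0 1", simplified, THEN eventually_mono]) auto
  ultimately show "\<forall>\<^sub>F z in nhds 0. (\<lambda>r. fps_nth ?F r * z ^ r) sums polylog k z"
    by (auto elim: eventually_mono)
qed

lemma gabpdp_factor_expansion:
  "\<exists>F. (\<lambda>x. (1 + x) powr of_real \<gamma> * (Ln (1 + x) / polylog k (1 - exp (- x))) *
      exp (of_real \<eta> * x)) has_laurent_expansion fps_to_fls F"
proof -
  define P :: "complex fps" where "P = Abs_fps (\<lambda>r. if r = 0 then 0 else 1 / of_nat r powi k)"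
  define Q where "Q = fps_compose P (1 - fps_exp (-1))"
  have 1: "(\<lambda>x. polylog k (1 - exp (- x))) has_fps_expansion Q"
    unfolding Q_def
  proof -
    have "(\<lambda>x. 1 - exp (- x)) has_fps_expansion (1 - fps_exp (-1 :: complex))"
      by (intro fps_expansion_intros)
    from has_fps_expansion_compose[OF polylog_expansion[of k, folded P_def] this]
    show "(\<lambda>x. polylog k (1 - exp (- x))) has_fps_expansion fps_compose P (1 - fps_exp (-1))"
      by (simp add: o_def)
  qed
  have Q: "fps_nth Q 0 = 0" "fps_nth Q 1 = 1"
    by (simp_all add: Q_def P_def fps_compose_nth)
  have "(\<lambda>x. Ln (1 + x)) analytic_on {0}"
    by (auto intro!: analytic_intros)
  then obtain L where L: "(\<lambda>x. Ln (1 + x)) has_fps_expansion L"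
    using analytic_at_imp_has_fps_expansion_0 by blast
  have L0: "fps_nth L 0 = 0"
    using has_fps_expansion_imp_0_eq_fps_nth_0[OF L] by simp
  have sQ: "subdegree Q = 1" using Q by (intro subdegreeI) auto
  have "Q dvd L"
  proof (cases "L = 0")
    case False
    then have "subdegree L \<ge> 1" using L0 by (intro subdegree_geI) auto
    with sQ show ?thesis using False Q by (subst fps_dvd_iff) auto
  qed auto
  then obtain R where R: "L = Q * R" by (elim dvdE)
  have Q0: "Q \<noteq> 0" using Q by auto
  have "(\<lambda>x. Ln (1 + x) / polylog k (1 - exp (- x))) has_laurent_expansion
      (fps_to_fls L / fps_to_fls Q)"
    by (intro laurent_expansion_intros has_laurent_expansion_fps L 1)
  also have "fps_to_fls L / fps_to_fls Q = fps_to_fls R"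
    using Q0 by (simp add: R fls_times_fps_to_fls)
  finally have 2: "(\<lambda>x. Ln (1 + x) / polylog k (1 - exp (- x))) has_laurent_expansion fps_to_fls R" .
  have "(\<lambda>x. (1 + x) powr of_real \<gamma> :: complex) analytic_on {0}"
    by (auto intro!: analytic_intros)
  then obtain G where G: "(\<lambda>x. (1 + x :: complex) powr of_real \<gamma>) has_fps_expansion G"
    using analytic_at_imp_has_fps_expansion_0 by blast
  have "(\<lambda>x. (1 + x) powr of_real \<gamma> * (Ln (1 + x) / polylog k (1 - exp (- x))) *
      exp (of_real \<eta> * x)) has_laurent_expansion (fps_to_fls G * fps_to_fls R * fps_to_fls (fps_exp (of_real \<eta>)))"
    by (intro laurent_expansion_intros has_laurent_expansion_fps G 2 fps_expansion_intros)
  thus ?thesis unfolding fls_times_fps_to_fls[symmetric] by blast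
qed

lemma gabpdp_base_expansion:
  assumes "m \<ge> 1"
  shows "\<exists>B. (\<lambda>x. x ^ m / (of_real lam * exp x - (\<Sum>i<m. x ^ i / fact i))) has_laurent_expansion
    fps_to_fls B \<and> B \<noteq> 0 \<and> (lam = 1 \<longrightarrow> fps_nth B 0 = fact m)"
proof -
  define D :: "complex fps" where
    "D = fps_const (of_real lam) * fps_exp 1 - (\<Sum>i<m. fps_X ^ i * fps_const (1 / fact i))"
  have Dn: "fps_nth D n = (of_real lam - (if n < m then 1 else 0)) / fact n" for n
  proof -
    have "(\<Sum>i<m. fps_nth (fps_X ^ i * fps_const (1 / fact i) :: complex fps) n) =
        (\<Sum>i<m. if i = n then 1 / fact n else 0)"
      by (intro sum.cong) (auto simp: fps_X_power_nth)
    thus ?thesis by (simp add: D_def fps_sum_nth diff_divide_distrib)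
  qed
  have "fps_nth D m \<noteq> 0 \<or> fps_nth D 0 \<noteq> 0" using assms by (auto simp: Dn)
  hence D0: "D \<noteq> 0" by auto
  have sD: "subdegree D \<le> m"
    using \<open>fps_nth D m \<noteq> 0 \<or> fps_nth D 0 \<noteq> 0\<close> subdegree_leI[of D m] subdegree_leI[of D 0] by auto
  obtain B where B: "fps_X ^ m = D * B"
    using sD D0 by (metis dvdE fps_X_neq_zero fps_dvd_iff fps_X_power_subdegree power_not_zero)
  have "(\<lambda>x. of_real lam * exp x - (\<Sum>i<m. x ^ i * (1 / fact i))) has_fps_expansion D"
    unfolding D_def by (intro fps_expansion_intros)
  hence "(\<lambda>x. of_real lam * exp x - (\<Sum>i<m. x ^ i / fact i)) has_fps_expansion D"
    by simp
  hence "(\<lambda>x. x ^ m / (of_real lam * exp x - (\<Sum>i<m. x ^ i / fact i))) has_laurent_expansion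
      (fps_to_fls (fps_X ^ m) / fps_to_fls D)"
    by (intro laurent_expansion_intros has_laurent_expansion_fps fps_expansion_intros)
  also have "fps_to_fls (fps_X ^ m) / fps_to_fls D = fps_to_fls B"
    using D0 by (simp add: B fls_times_fps_to_fls)
  finally have 1: "(\<lambda>x. x ^ m / (of_real lam * exp x - (\<Sum>i<m. x ^ i / fact i)))
      has_laurent_expansion fps_to_fls B" .
  have "B \<noteq> 0" using B by auto
  moreover have "fps_nth B 0 = fact m" if "lam = 1"
  proof -
    have "fps_nth (D * B) m = (\<Sum>i=0..m. fps_nth D i * fps_nth B (m - i))"
      by (simp add: fps_mult_nth)
    also have "\<dots> = (\<Sum>i\<in>{m}. fps_nth D i * fps_nth B (m - i))"
      using that by (intro sum.mono_neutral_right) (auto simp: Dn)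
    finally show ?thesis using that B[symmetric] by (simp add: Dn fps_X_power_nth field_simps)
  qed
  ultimately show ?thesis using 1 by blast
qed

(* Non-vacuity: for lam = 1 every order a is admissible, and for other lam every a in \<nat>. *)
lemma gabpdp_expansion_exists:
  assumes "m \<ge> 1" and "lam = 1 \<or> a \<in> \<nat>"
  shows "\<exists>F. gabpdp_expansion k m a \<gamma> \<eta> lam F"
proof -
  define b where "b = (\<lambda>x. x ^ m / (of_real lam * exp x - (\<Sum>i<m. x ^ i / fact i :: complex)))"
  obtain B where B: "b has_laurent_expansion fps_to_fls B" "B \<noteq> 0"
      "lam = 1 \<longrightarrow> fps_nth B 0 = fact m"
    using gabpdp_base_expansion[OF assms(1), of lam] unfolding b_def by blast
  have ev: "\<forall>\<^sub>F x in at 0. b x \<noteq> 0"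
    using B has_laurent_expansion_nonzero_imp_eventually_nonzero[OF B(1)] by simp
  have "\<exists>A. (\<lambda>x. b x powr a) has_laurent_expansion fps_to_fls A"
    using assms(2)
  proof
    assume "a \<in> \<nat>"
    then obtain q where q: "a = of_nat q" by (elim Nats_cases)
    have "(\<lambda>x. b x ^ q) has_laurent_expansion fps_to_fls (B ^ q)"
      by (simp add: fps_to_fls_power B laurent_expansion_intros)
    moreover have "\<forall>\<^sub>F x in at 0. b x ^ q = b x powr a"
      using ev by eventually_elim (simp add: q powr_nat')
    ultimately show ?thesis
      using has_laurent_expansion_cong[of "\<lambda>x. b x ^ q" "\<lambda>x. b x powr a"] by blast
  next
    assume l: "lam = 1"
    have e: "\<forall>\<^sub>F x in at 0. eval_fls (fps_to_fls B) x = b x" and r: "fps_conv_radius B > 0"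
      using B(1) by (auto simp: has_laurent_expansion_def)
    have "eval_fps B has_fps_expansion B" using r by (simp add: eval_fps_has_fps_expansion)
    hence "eval_fps B analytic_on {0}" by (rule has_fps_expansion_imp_analytic_0)
    moreover have "eval_fps B 0 = of_nat (fact m)"
      using B(3) l by (simp add: eval_fps_at_0)
    ultimately have "(\<lambda>x. eval_fps B x powr a) analytic_on {0}"
      by (intro analytic_on_powr) (auto simp del: of_nat_fact)
    then obtain A where A: "(\<lambda>x. eval_fps B x powr a) has_fps_expansion A"
      using analytic_at_imp_has_fps_expansion_0 by blast
    have "\<forall>\<^sub>F x in at 0. x \<in> eball (0::complex) (fps_conv_radius B)"
      using r by (intro eventually_at_in_open' open_eball) (auto simp: zero_ereal_def)
    with e have "\<forall>\<^sub>F x in at 0. eval_fps B x powr a = b x powr a"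
      by eventually_elim (simp add: eval_fps_to_fls)
    thus ?thesis
      using has_laurent_expansion_fps[OF A]
        has_laurent_expansion_cong[of "\<lambda>x. eval_fps B x powr a" "\<lambda>x. b x powr a"] by blast
  qed
  then obtain A where A: "(\<lambda>x. b x powr a) has_laurent_expansion fps_to_fls A" by blast
  obtain F where F: "(\<lambda>x. (1 + x) powr of_real \<gamma> * (Ln (1 + x) / polylog k (1 - exp (- x))) *
      exp (of_real \<eta> * x)) has_laurent_expansion fps_to_fls F"
    using gabpdp_factor_expansion by blast
  have "gabpdp_gen k m a \<gamma> \<eta> lam has_laurent_expansion fps_to_fls F * fps_to_fls A"
    using has_laurent_expansion_mult[OF F A] unfolding gabpdp_gen_def[abs_def] b_def .
  thus ?thesis unfolding gabpdp_expansion_def fls_times_fps_to_fls[symmetric] by blast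
qed

end

theory Submission
  imports Defs
begin

text \<open>The parameter \<eta> enters the generating function only through the factor
  \<open>exp (of_real \<eta> * x)\<close>, so raising it by 1 multiplies the series by that of
  \<open>exp x\<close>; the Cauchy product then yields the binomial sum.
  \<open>gabpdp_expansion_shift\<close> carries this for any real shift \<open>c\<close>:
  \<open>c = 1\<close> gives the recurrence, while \<open>c = - 1\<close> reverses it, so that the
  default value 0 occurs for \<eta> and \<eta> + 1 simultaneously.\<close>

lemma gabpdp_expansion_shift:
  assumes "gabpdp_expansion k m a \<gamma> \<eta> lam F"
  shows "gabpdp_expansion k m a \<gamma> (\<eta> + c) lam (fps_exp (of_real c) * F)"
proof -
  \<comment> \<open>This holds at every \<open>x\<close>, with no restriction to a punctured
    neighbourhood: the principal powers do not involve \<eta>.\<close>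
  have "gabpdp_gen k m a \<gamma> (\<eta> + c) lam = (\<lambda>x. exp (of_real c * x) * gabpdp_gen k m a \<gamma> \<eta> lam x)"
    by (simp add: fun_eq_iff gabpdp_gen_def distrib_right exp_add)
  moreover have "(\<lambda>x. exp (of_real c * x) * gabpdp_gen k m a \<gamma> \<eta> lam x)
      has_laurent_expansion fps_to_fls (fps_exp (of_real c)) * fps_to_fls F"
    using has_laurent_expansion_fps[OF has_fps_expansion_exp] assms
    unfolding gabpdp_expansion_def by (rule has_laurent_expansion_mult)
  ultimately show ?thesis
    by (simp add: gabpdp_expansion_def fls_times_fps_to_fls)
qed

theorem theorem3p4:
  fixes \<gamma> \<eta> lam :: real and a :: complex and k :: int and m n :: nat
  assumes "m \<ge> 1"
  shows "gabpdp k m a n \<gamma> (\<eta> + 1) lam =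
    (\<Sum>j=0..n. of_nat (n choose j) * gabpdp k m a (n - j) \<gamma> \<eta> lam)"
proof (cases "\<exists>F. gabpdp_expansion k m a \<gamma> \<eta> lam F")
  case True
  then obtain F where F: "gabpdp_expansion k m a \<gamma> \<eta> lam F" ..
  have "gabpdp k m a n \<gamma> (\<eta> + 1) lam = fact n * fps_nth (fps_exp 1 * F) n"
    using gabpdp_eq[OF gabpdp_expansion_shift[OF F, of 1]] by simp
  also have "\<dots> = (\<Sum>j=0..n. fact n / fact j * fps_nth F (n - j))"
    by (simp add: fps_mult_nth sum_distrib_left)
  \<comment> \<open>The factor \<open>fact (n - j)\<close> split off here turns the coefficient of
    \<open>F\<close> back into a \<open>gabpdp\<close> value.\<close>
  also have "\<dots> = (\<Sum>j=0..n. of_nat (n choose j) * (fact (n - j) * fps_nth F (n - j)))"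
    by (intro sum.cong) (simp_all add: binomial_fact)
  finally show ?thesis
    by (simp add: gabpdp_eq[OF F])
next
  case False
  \<comment> \<open>Shifting back by \<open>- 1\<close> shows that \<open>\<eta> + 1\<close> has no expansion either, so both sides are 0.\<close>
  have "\<nexists>F. gabpdp_expansion k m a \<gamma> (\<eta> + 1) lam F"
  proof
    assume "\<exists>F. gabpdp_expansion k m a \<gamma> (\<eta> + 1) lam F"
    then obtain F where "gabpdp_expansion k m a \<gamma> (\<eta> + 1) lam F" ..
    from gabpdp_expansion_shift[OF this, of "- 1"] False show False by simp
  qed
  with False show ?thesis by (simp add: gabpdp_def)
qed

end
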